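(* Let $G$ be a nontrivial ordered additive abelian group. Then \[ \mathcal{R}_G(3,4) = \{10\}\cup[12,20] \qquad\text{and}\qquad \mathcal{R}_G(3,5) = \{13\}\cup[15,35]. \]
   Context: An additive abelian group $G$ is ordered with respect to a total order $<$ if $x<y$ implies $x+z<y+z$ for all $x,y,z\in G$. For real $u,v$, $[u,v]=\{c\in\mathbb{Z}: u\le c\le v\}$. For a nonempty subset $A$ of $G$ and a positive integer $h$, $hA=\{a_1+\cdots+a_h : a_i\in A\}$ (summands not necessarily distinct). $\mathcal{R}_G(h,k)=\{|hA| : A\subseteq G,\ |A|=k\}$. *)

theory Defs
  imports Main
begin

definition hfold_sumset :: "nat \<Rightarrow> 'a::comm_monoid_add set \<Rightarrow> 'a set" where
  "hfold_sumset h A = {\<Sum>i<h. a i | a. \<forall>i<h. a i \<in> A}"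

text \<open>The ambient group is the whole type, passed as a type argument.  Finiteness is
  explicit because \<^const>\<open>card\<close> returns 0 on infinite sets.\<close>

definition sumset_sizes :: "'a::comm_monoid_add itself \<Rightarrow> nat \<Rightarrow> nat \<Rightarrow> nat set" where
  "sumset_sizes G h k =
     {card (hfold_sumset h A) | A :: 'a set. finite A \<and> card A = k}"

end

theory Submission
  imports Defs "HOL-Library.Multiset"
begin

text \<open>
  The upper bounds count multisets of size 3. For the lower bounds, adjoining to a set a new
  maximum or minimum adds at least three elements to its threefold sumset. A three-term set that
  is not an arithmetic progression has at least nine threefold sums. A set of four or five
  elements that is not a progression remains so after the removal of its minimum or of its
  maximum, so its threefold sumset has at least \<open>3 k\<close> elements, whereas a progression has exactly
  \<open>3 k - 2\<close> of them. All remaining sizes are attained by sets of multiples of one positive element.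
\<close>

section \<open>Recursion for sumsets and their behaviour under additive maps and
  translations\<close>

lemma hfold_sumset_0 [simp]: "hfold_sumset 0 A = {0}"
  by (auto simp: hfold_sumset_def)

lemma hfold_sumset_Suc:
  "hfold_sumset (Suc h) A = {x + y | x y. x \<in> hfold_sumset h A \<and> y \<in> A}"
proof (intro equalityI subsetI)
  fix s assume "s \<in> hfold_sumset (Suc h) A"
  then obtain a where a: "\<forall>i<Suc h. a i \<in> A" "s = (\<Sum>i<Suc h. a i)"
    unfolding hfold_sumset_def by blast
  then have "(\<Sum>i<h. a i) \<in> hfold_sumset h A" "a h \<in> A" "s = (\<Sum>i<h. a i) + a h"
    unfolding hfold_sumset_def by auto
  then show "s \<in> {x + y | x y. x \<in> hfold_sumset h A \<and> y \<in> A}" by blast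
next
  fix s assume "s \<in> {x + y | x y. x \<in> hfold_sumset h A \<and> y \<in> A}"
  then obtain a y where a: "\<forall>i<h. a i \<in> A" "y \<in> A" "s = (\<Sum>i<h. a i) + y"
    unfolding hfold_sumset_def by blast
  have "(\<Sum>i<h. (a(h := y)) i) = (\<Sum>i<h. a i)"
    by (rule sum.cong) auto
  then have "s = (\<Sum>i<Suc h. (a(h := y)) i)" "\<forall>i<Suc h. (a(h := y)) i \<in> A"
    using a by (auto simp: less_Suc_eq)
  then show "s \<in> hfold_sumset (Suc h) A"
    unfolding hfold_sumset_def by blast
qed

lemma finite_hfold_sumset: "finite A \<Longrightarrow> finite (hfold_sumset h A)"
  by (induction h) (simp_all add: hfold_sumset_Suc finite_image_set2)

lemma hfold_sumset_mono: "A \<subseteq> B \<Longrightarrow> hfold_sumset h A \<subseteq> hfold_sumset h B"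
  unfolding hfold_sumset_def by blast

lemma hfold_sumset_additive_image:
  assumes "f 0 = 0" "\<And>x y. f (x + y) = f x + f y"
  shows "hfold_sumset h (f ` A) = f ` hfold_sumset h A"
proof (induction h)
  case (Suc h)
  have "{x + y | x y. x \<in> f ` X \<and> y \<in> f ` A} = f ` {x + y | x y. x \<in> X \<and> y \<in> A}" for X
    using assms(2) by (fastforce simp: image_iff)
  with Suc show ?case by (simp add: hfold_sumset_Suc)
qed (simp add: assms)

lemma hfold_sumset_translate:
  fixes a :: "'a::comm_monoid_add"
  shows "hfold_sumset h ((+) a ` A) = (+) (\<Sum>i<h. a) ` hfold_sumset h A"
proof (induction h)
  case (Suc h)
  have "{x + y | x y. x \<in> (+) b ` X \<and> y \<in> (+) a ` A}
      = (+) (b + a) ` {x + y | x y. x \<in> X \<and> y \<in> A}" for X b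
    by (auto simp: image_iff) (metis add.assoc add.left_commute)+
  with Suc show ?case by (simp add: hfold_sumset_Suc)
qed simp

lemma hfold_sumset_3:
  "hfold_sumset 3 A = {x + y + z | x y z. x \<in> A \<and> y \<in> A \<and> z \<in> A}"
  by (auto simp: eval_nat_numeral hfold_sumset_Suc)

lemma hfold_sumset_3I: "x \<in> A \<Longrightarrow> y \<in> A \<Longrightarrow> z \<in> A \<Longrightarrow> x + y + z \<in> hfold_sumset 3 A"
  unfolding hfold_sumset_3 by blast

section \<open>Upper bound by counting multisets\<close>

text \<open>By commutativity a sum depends only on the multiset of its summands, so
  \<open>sum_mset\<close> maps the multisets of size \<open>h\<close> over \<open>A\<close> onto a
  superset of the sumset. For \<open>h = 3\<close> the bound is 20 when \<open>A\<close> has 4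
  elements and 35 when it has 5.\<close>

lemma card_hfold_sumset_le:
  assumes "finite A"
  shows "card (hfold_sumset h A) \<le> (card A + h - 1) choose h"
proof -
  have "hfold_sumset h A \<subseteq> sum_mset ` multisets_of_size A h"
  proof (induction h)
    case (Suc h)
    show ?case
    proof
      fix s assume "s \<in> hfold_sumset (Suc h) A"
      then obtain x y where "x \<in> hfold_sumset h A" "y \<in> A" "s = x + y"
        unfolding hfold_sumset_Suc by blast
      moreover from this Suc obtain X where "X \<in> multisets_of_size A h" "x = sum_mset X"
        by auto
      ultimately have "add_mset y X \<in> multisets_of_size A (Suc h)" "s = sum_mset (add_mset y X)"
        by (auto simp: multisets_of_size_def add.commute)
      then show "s \<in> sum_mset ` multisets_of_size A (Suc h)" by blast
    qed
  qed simp
  then have "card (hfold_sumset h A) \<le> card (multisets_of_size A h)"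
    using assms by (intro surj_card_le finite_multisets_of_size)
  also have "\<dots> = (card A + h - 1) choose h"
    by (rule card_multisets_of_size[OF assms])
  finally show ?thesis .
qed

section \<open>Transfer to computations with natural numbers\<close>

definition multiple :: "nat \<Rightarrow> 'a::comm_monoid_add \<Rightarrow> 'a" where
  "multiple n x = (\<Sum>i<n. x)"

lemma multiple_simps [simp]:
  "multiple 0 x = 0" "multiple (Suc n) x = multiple n x + x"
  by (simp_all add: multiple_def)

lemma multiple_add: "multiple (m + n) x = multiple m x + multiple n x"
  by (induction m) (simp_all add: ac_simps)

text \<open>Adding a positive \<open>x\<close> strictly increases an element, so the multiples of
  \<open>x\<close> form an ordered copy of the natural numbers inside the group.\<close>

lemma inj_multiple:
  fixes x :: "'a::linordered_ab_group_add"
  assumes "0 < x"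
  shows "inj (\<lambda>n. multiple n x)"
proof -
  have "strict_mono (\<lambda>n. multiple n x)"
    using assms by (simp add: strict_mono_Suc_iff)
  then show ?thesis by (rule strict_mono_imp_inj_on)
qed

text \<open>Executable counterpart of the sumset of a set of natural numbers; \<open>remdups\<close>
  makes the length of the list equal to the size of the sumset.\<close>

fun hfold_list :: "nat \<Rightarrow> nat list \<Rightarrow> nat list" where
  "hfold_list 0 xs = [0]"
| "hfold_list (Suc h) xs = remdups (concat (map (\<lambda>x. map ((+) x) (hfold_list h xs)) xs))"

lemma set_hfold_list: "set (hfold_list h xs) = hfold_sumset h (set xs)"
proof (induction h)
  case (Suc h)
  have "set (hfold_list (Suc h) xs) = {y + x | x y. x \<in> set (hfold_list h xs) \<and> y \<in> set xs}"
    by auto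
  with Suc show ?case by (simp add: hfold_sumset_Suc add.commute)
qed simp

lemma distinct_hfold_list: "distinct (hfold_list h xs)"
  by (cases h) auto

text \<open>The map is an injective additive map followed by a translation, and neither changes the
  size of a sumset. The offset \<open>a\<close> serves for arbitrary progressions; the examples take
  \<open>a = 0\<close>.\<close>

lemma card_hfold_sumset_affine_image:
  fixes a d :: "'a::linordered_ab_group_add"
  assumes "0 < d"
  shows "card (hfold_sumset h ((\<lambda>n. a + multiple n d) ` set xs)) = length (hfold_list h xs)"
proof -
  have "(\<lambda>n. a + multiple n d) ` set xs = (+) a ` (\<lambda>n. multiple n d) ` set xs"
    by (simp add: image_image)
  then have "hfold_sumset h ((\<lambda>n. a + multiple n d) ` set xs)
      = (+) (\<Sum>i<h. a) ` (\<lambda>n. multiple n d) ` hfold_sumset h (set xs)"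
    by (simp only: hfold_sumset_translate
        hfold_sumset_additive_image[of "\<lambda>n. multiple n d", OF multiple_simps(1) multiple_add])
  then have "card (hfold_sumset h ((\<lambda>n. a + multiple n d) ` set xs))
      = card (hfold_sumset h (set xs))"
    using inj_multiple[OF assms] by (simp add: card_image inj_on_subset)
  then show ?thesis
    by (simp add: set_hfold_list[symmetric] distinct_card distinct_hfold_list)
qed

lemma length_hfold_list_in_sumset_sizes:
  fixes x :: "'a::linordered_ab_group_add"
  assumes "0 < x" "distinct xs"
  shows "length (hfold_list h xs) \<in> sumset_sizes TYPE('a) h (length xs)"
proof -
  let ?A = "(\<lambda>n. 0 + multiple n x) ` set xs"
  have "card ?A = length xs"
    using inj_multiple[OF assms(1)] assms(2)
    by (simp add: card_image inj_on_subset distinct_card)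
  moreover have "card (hfold_sumset h ?A) = length (hfold_list h xs)"
    by (rule card_hfold_sumset_affine_image[OF assms(1)])
  ultimately show ?thesis
    unfolding sumset_sizes_def by (auto intro!: exI[of _ ?A])
qed

section \<open>Lower bounds for threefold sumsets\<close>

text \<open>All old sums are at most \<open>m + m + m\<close>, and replacing the copies of
  \<open>m\<close> by \<open>M\<close> one after another gives three increasing sums above
  it.\<close>

lemma card_hfold_sumset_insert_greater:
  fixes M m :: "'a::linordered_ab_group_add"
  assumes "finite A" "m \<in> A" "\<And>x. x \<in> A \<Longrightarrow> x \<le> m" "m < M"
  shows "card (hfold_sumset 3 A) + 3 \<le> card (hfold_sumset 3 (insert M A))"
proof -
  let ?N = "{m + m + M, m + M + M, M + M + M}"
  have less: "m + m + m < m + m + M" "m + m + M < m + M + M" "m + M + M < M + M + M"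
    using assms(4) by (simp_all add: add_strict_right_mono)
  have "s \<le> m + m + m" if "s \<in> hfold_sumset 3 A" for s
    using that assms(3) unfolding hfold_sumset_3 by (auto intro!: add_mono)
  moreover have "m + m + m < s" if "s \<in> ?N" for s
    using that less by (elim insertE emptyE) (metis less_trans)+
  ultimately have "hfold_sumset 3 A \<inter> ?N = {}"
    by (meson disjoint_iff not_le)
  moreover have "card ?N = 3"
    using less less_imp_neq[OF less_trans[OF less(2,3)]] by auto
  ultimately have "card (hfold_sumset 3 A) + 3 = card (hfold_sumset 3 A \<union> ?N)"
    using assms(1) by (subst card_Un_disjoint) (simp_all only: finite_hfold_sumset finite.intros)
  also have "\<dots> \<le> card (hfold_sumset 3 (insert M A))"
  proof (rule card_mono)
    have "hfold_sumset 3 A \<subseteq> hfold_sumset 3 (insert M A)"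
      by (intro hfold_sumset_mono) auto
    moreover have "?N \<subseteq> hfold_sumset 3 (insert M A)"
      using assms(2) by (auto intro!: hfold_sumset_3I)
    ultimately show "hfold_sumset 3 A \<union> ?N \<subseteq> hfold_sumset 3 (insert M A)" by blast
  qed (use assms(1) in \<open>simp add: finite_hfold_sumset\<close>)
  finally show ?thesis .
qed

text \<open>Negation reverses the order and preserves sizes of sumsets, so a new minimum becomes a
  new maximum.\<close>

lemma card_hfold_sumset_insert_less:
  fixes M m :: "'a::linordered_ab_group_add"
  assumes "finite A" "m \<in> A" "\<And>x. x \<in> A \<Longrightarrow> m \<le> x" "M < m"
  shows "card (hfold_sumset 3 A) + 3 \<le> card (hfold_sumset 3 (insert M A))"
proof -
  have neg: "card (hfold_sumset 3 (uminus ` B)) = card (hfold_sumset 3 B)" for B :: "'a set"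
    by (subst hfold_sumset_additive_image) (auto simp: card_image)
  have "card (hfold_sumset 3 (uminus ` A)) + 3
      \<le> card (hfold_sumset 3 (insert (- M) (uminus ` A)))"
    using assms by (intro card_hfold_sumset_insert_greater[of _ "- m"]) auto
  then show ?thesis
    using neg[of A] neg[of "insert M A"] by simp
qed

text \<open>Nine of the ten formal sums are put into a strictly increasing chain. The order of
  \<open>a\<close>, \<open>b\<close>, \<open>c\<close> leaves open only \<open>a + b + b\<close>
  against \<open>a + a + c\<close> and \<open>b + b + c\<close> against \<open>a + c + c\<close>;
  both are decided by comparing \<open>b + b\<close> with \<open>a + c\<close>. The sum
  \<open>b + b + b\<close> is left out because it may coincide with \<open>a + a + c\<close> or
  \<open>a + c + c\<close>.\<close>

lemma card_hfold_sumset_3_not_progression: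
  fixes a b c :: "'a::linordered_ab_group_add"
  assumes "a < b" "b < c" "b + b \<noteq> a + c"
  shows "9 \<le> card (hfold_sumset 3 {a, b, c})"
proof -
  \<comment> \<open>A strictly increasing list has distinct entries, so its length bounds the size
    of the sumset from below.\<close>
  have chain: "length xs \<le> card (hfold_sumset 3 {a, b, c})"
    if "sorted_wrt (<) xs" "set xs \<subseteq> hfold_sumset 3 {a, b, c}" for xs
    using that strict_sorted_iff[of xs] card_mono[of "hfold_sumset 3 {a, b, c}" "set xs"]
    by (simp add: distinct_card finite_hfold_sumset)
  have [simp]: "a < b" "b < c" using assms by auto
  have less:
    "a + a + a < a + a + b" "a + a + b < a + b + b" "a + a + b < a + a + c"
    "a + b + b < a + b + c" "a + a + c < a + b + c" "a + b + c < b + b + c"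
    "a + b + c < a + c + c" "b + b + c < b + c + c" "a + c + c < b + c + c"
    "b + c + c < c + c + c"
    by (simp_all add: add_strict_left_mono add_strict_right_mono)
  have mem: "a + a + a \<in> hfold_sumset 3 {a, b, c}" "a + a + b \<in> hfold_sumset 3 {a, b, c}"
    "a + b + b \<in> hfold_sumset 3 {a, b, c}" "a + a + c \<in> hfold_sumset 3 {a, b, c}"
    "a + b + c \<in> hfold_sumset 3 {a, b, c}" "b + b + c \<in> hfold_sumset 3 {a, b, c}"
    "a + c + c \<in> hfold_sumset 3 {a, b, c}" "b + c + c \<in> hfold_sumset 3 {a, b, c}"
    "c + c + c \<in> hfold_sumset 3 {a, b, c}"
    by (auto intro!: hfold_sumset_3I)
  consider "b + b < a + c" | "a + c < b + b" using assms(3) by (meson linorder_neqE)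
  then show ?thesis
  proof cases
    case 1
    have "a + b + b < a + a + c" "b + b + c < a + c + c"
      using add_strict_left_mono[OF 1, of a] add_strict_right_mono[OF 1, of c]
      by (simp_all add: add.assoc)
    then have "sorted_wrt (<) [a + a + a, a + a + b, a + b + b, a + a + c, a + b + c,
        b + b + c, a + c + c, b + c + c, c + c + c]"
      using less by (simp only: sorted_wrt2_simps transp_on_less simp_thms)
    from chain[OF this] mem show ?thesis by simp
  next
    case 2
    have "a + a + c < a + b + b" "a + c + c < b + b + c"
      using add_strict_left_mono[OF 2, of a] add_strict_right_mono[OF 2, of c]
      by (simp_all add: add.assoc)
    then have "sorted_wrt (<) [a + a + a, a + a + b, a + a + c, a + b + b, a + b + c,
        a + c + c, b + b + c, b + c + c, c + c + c]"
      using less by (simp only: sorted_wrt2_simps transp_on_less simp_thms)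
    from chain[OF this] mem show ?thesis by simp
  qed
qed

lemma card_hfold_sumset_3_of_4:
  fixes a b c d :: "'a::linordered_ab_group_add"
  assumes "a < b" "b < c" "c < d" "\<not> (b + b = a + c \<and> c + c = b + d)"
  shows "12 \<le> card (hfold_sumset 3 {a, b, c, d})"
proof (cases "b + b = a + c")
  case True
  with assms have "9 \<le> card (hfold_sumset 3 {b, c, d})"
    by (intro card_hfold_sumset_3_not_progression) auto
  also have "\<dots> + 3 \<le> card (hfold_sumset 3 (insert a {b, c, d}))"
    using assms by (intro card_hfold_sumset_insert_less[of _ b]) auto
  finally show ?thesis by simp
next
  case False
  with assms have "9 \<le> card (hfold_sumset 3 {a, b, c})"
    by (intro card_hfold_sumset_3_not_progression) auto
  also have "\<dots> + 3 \<le> card (hfold_sumset 3 (insert d {a, b, c}))"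
    using assms by (intro card_hfold_sumset_insert_greater[of _ c]) auto
  finally show ?thesis by (simp add: insert_commute)
qed

text \<open>The same removal of an end point, one element higher: if \<open>a, b, c, d\<close> is a
  progression, then \<open>b, c, d, e\<close> is not, and 12 + 3 = 15.\<close>

lemma card_hfold_sumset_3_of_5:
  fixes a b c d e :: "'a::linordered_ab_group_add"
  assumes "a < b" "b < c" "c < d" "d < e"
    "\<not> (b + b = a + c \<and> c + c = b + d \<and> d + d = c + e)"
  shows "15 \<le> card (hfold_sumset 3 {a, b, c, d, e})"
proof (cases "b + b = a + c \<and> c + c = b + d")
  case True
  with assms have "12 \<le> card (hfold_sumset 3 {b, c, d, e})"
    by (intro card_hfold_sumset_3_of_4) auto
  also have "\<dots> + 3 \<le> card (hfold_sumset 3 (insert a {b, c, d, e}))"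
    using assms by (intro card_hfold_sumset_insert_less[of _ b]) auto
  finally show ?thesis by simp
next
  case False
  with assms have "12 \<le> card (hfold_sumset 3 {a, b, c, d})"
    by (intro card_hfold_sumset_3_of_4) auto
  also have "\<dots> + 3 \<le> card (hfold_sumset 3 (insert e {a, b, c, d}))"
    using assms by (intro card_hfold_sumset_insert_greater[of _ d]) auto
  finally show ?thesis by (simp add: insert_commute)
qed

section \<open>Progressions against all other sets: the gaps at 11 and 14\<close>

lemma card_hfold_sumset_3_cases_4:
  fixes A :: "'a::linordered_ab_group_add set"
  assumes "finite A" "card A = 4"
  shows "card (hfold_sumset 3 A) = 10 \<or> 12 \<le> card (hfold_sumset 3 A)"
proof -
  have "length (sorted_list_of_set A) = 4" using assms by simp
  then obtain a b c d where l: "sorted_list_of_set A = [a, b, c, d]"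
    by (simp only: eval_nat_numeral BitM.simps length_Suc_conv length_0_conv) blast
  then have A: "A = {a, b, c, d}" using set_sorted_list_of_set[OF assms(1)] by simp
  have less: "a < b" "b < c" "c < d" using strict_sorted_list_of_set[of A] l by auto
  show ?thesis
  proof (cases "b + b = a + c \<and> c + c = b + d")
    case True
    \<comment> \<open>The two equations say that consecutive differences agree; \<open>r\<close> is
      the common difference, and \<open>A\<close> becomes an affine image of 0, 1, 2, 3, whose
      threefold sums fill 0 to 9.\<close>
    define r where "r = b - a"
    have b: "b = a + r" by (simp add: r_def)
    have c: "c = a + r + r" using True unfolding b by (simp add: ac_simps)
    have d: "d = a + r + r + r" using True unfolding b c by (simp add: ac_simps)
    have "A = (\<lambda>n. a + multiple n r) ` set [0, 1, 2, 3]"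
      unfolding A b c d by (simp add: eval_nat_numeral add.assoc)
    moreover have "0 < r" using less by (simp add: r_def)
    moreover have "length (hfold_list 3 [0, 1, 2, 3]) = 10"
      by code_simp
    ultimately show ?thesis by (simp only: card_hfold_sumset_affine_image simp_thms)
  next
    case False
    then show ?thesis using card_hfold_sumset_3_of_4[OF less] A by simp
  qed
qed

lemma card_hfold_sumset_3_cases_5:
  fixes A :: "'a::linordered_ab_group_add set"
  assumes "finite A" "card A = 5"
  shows "card (hfold_sumset 3 A) = 13 \<or> 15 \<le> card (hfold_sumset 3 A)"
proof -
  have "length (sorted_list_of_set A) = 5" using assms by simp
  then obtain a b c d e where l: "sorted_list_of_set A = [a, b, c, d, e]"
    by (simp only: eval_nat_numeral BitM.simps length_Suc_conv length_0_conv) blast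
  then have A: "A = {a, b, c, d, e}" using set_sorted_list_of_set[OF assms(1)] by simp
  have less: "a < b" "b < c" "c < d" "d < e" using strict_sorted_list_of_set[of A] l by auto
  show ?thesis
  proof (cases "b + b = a + c \<and> c + c = b + d \<and> d + d = c + e")
    case True
    \<comment> \<open>As for four elements; the threefold sums of 0, 1, 2, 3, 4 fill 0 to
      12.\<close>
    define r where "r = b - a"
    have b: "b = a + r" by (simp add: r_def)
    have c: "c = a + r + r" using True unfolding b by (simp add: ac_simps)
    have d: "d = a + r + r + r" using True unfolding b c by (simp add: ac_simps)
    have e: "e = a + r + r + r + r" using True unfolding b c d by (simp add: ac_simps)
    have "A = (\<lambda>n. a + multiple n r) ` set [0, 1, 2, 3, 4]"
      unfolding A b c d e by (simp add: eval_nat_numeral add.assoc)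
    moreover have "0 < r" using less by (simp add: r_def)
    moreover have "length (hfold_list 3 [0, 1, 2, 3, 4]) = 13"
      by code_simp
    ultimately show ?thesis by (simp only: card_hfold_sumset_affine_image simp_thms)
  next
    case False
    then show ?thesis using card_hfold_sumset_3_of_5[OF less] A by simp
  qed
qed

section \<open>Realization of the remaining sizes\<close>

text \<open>Reduces the realization of many sizes to a single evaluation: each entry of
  \<open>xss\<close> lists the coefficients of a set of multiples of \<open>x\<close>, and
  \<open>ns\<close> collects the computed sizes.\<close>

lemma sumset_sizes_supersetI:
  fixes x :: "'a::linordered_ab_group_add"
  assumes "0 < x" "\<forall>xs\<in>set xss. distinct xs \<and> length xs = k"
    "map (\<lambda>xs. length (hfold_list h xs)) xss = ns"
  shows "set ns \<subseteq> sumset_sizes TYPE('a) h k"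
  using assms(2,3) length_hfold_list_in_sumset_sizes[OF assms(1)] by fastforce

lemma sumset_sizes_3_4_superset:
  fixes x :: "'a::linordered_ab_group_add"
  assumes "0 < x"
  shows "{10} \<union> {12..20} \<subseteq> sumset_sizes TYPE('a) 3 4"
proof -
  \<comment> \<open>One explicit set per size, in the order 10, 12, 13, ..., 20. For the last one
    all 20 sums of three elements are distinct.\<close>
  let ?xss = "[[0,1,2,3], [0,1,2,4], [0,1,3,4], [0,1,2,5], [0,1,2,6], [0,1,4,5], [0,1,4,6],
      [0,1,5,7], [0,1,5,8], [0,1,7,11]]"
  have "map (\<lambda>xs. length (hfold_list 3 xs)) ?xss = 10 # [12..<21]"
    by code_simp
  then have "set (10 # [12..<21]) \<subseteq> sumset_sizes TYPE('a) 3 4"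
    by (intro sumset_sizes_supersetI[OF assms, of ?xss]) simp_all
  moreover have "set (10 # [12..<21]) = {10} \<union> {12..20::nat}"
    unfolding list.set set_upt by auto
  ultimately show ?thesis by (simp only:)
qed

lemma sumset_sizes_3_5_superset:
  fixes x :: "'a::linordered_ab_group_add"
  assumes "0 < x"
  shows "{13} \<union> {15..35} \<subseteq> sumset_sizes TYPE('a) 3 5"
proof -
  \<comment> \<open>Again one set per size, in the order 13, 15, 16, ..., 35; the last has 35
    distinct sums, the maximum.\<close>
  let ?xss = "[[0,1,2,3,4], [0,1,2,3,5], [0,1,2,4,5], [0,1,2,3,6], [0,1,3,4,6], [0,1,2,5,6],
      [0,1,2,5,7], [0,1,2,6,7], [0,1,3,6,7], [0,1,3,6,8], [0,1,3,7,8], [0,1,4,7,8],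
      [0,1,3,8,9], [0,1,4,9,10], [0,1,6,9,11], [0,1,4,9,11], [0,1,4,10,12], [0,1,4,11,13],
      [0,1,9,11,14], [0,1,7,12,16], [0,1,5,16,19], [0,1,15,18,23]]"
  have "map (\<lambda>xs. length (hfold_list 3 xs)) ?xss = 13 # [15..<36]"
    by code_simp
  then have "set (13 # [15..<36]) \<subseteq> sumset_sizes TYPE('a) 3 5"
    by (intro sumset_sizes_supersetI[OF assms, of ?xss]) simp_all
  moreover have "set (13 # [15..<36]) = {13} \<union> {15..35::nat}"
    unfolding list.set set_upt by auto
  ultimately show ?thesis by (simp only:)
qed

theorem theorem8:
  assumes nontrivial: "\<exists>x::'a::linordered_ab_group_add. x \<noteq> 0"
  shows "sumset_sizes TYPE('a) 3 4 = {10} \<union> {12..20} \<and>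
         sumset_sizes TYPE('a) 3 5 = {13} \<union> {15..35}"
proof -
  \<comment> \<open>A nonzero element or its negative is positive.\<close>
  obtain x :: 'a where "0 < x"
    using nontrivial by (metis neg_0_less_iff_less linorder_neqE)
  then have "{10} \<union> {12..20} \<subseteq> sumset_sizes TYPE('a) 3 4"
    "{13} \<union> {15..35} \<subseteq> sumset_sizes TYPE('a) 3 5"
    by (rule sumset_sizes_3_4_superset, rule sumset_sizes_3_5_superset)
  \<comment> \<open>The dichotomy gives the lower end and excludes 11; the multiset count C(6,3) =
    20 gives the upper end. For five elements the count is C(7,3) = 35.\<close>
  moreover have "card (hfold_sumset 3 A) \<in> {10} \<union> {12..20}"
    if "finite A" "card A = 4" for A :: "'a set"
    using card_hfold_sumset_3_cases_4[OF that] card_hfold_sumset_le[OF that(1), of 3] that(2)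
    by (auto simp: eval_nat_numeral)
  moreover have "card (hfold_sumset 3 A) \<in> {13} \<union> {15..35}"
    if "finite A" "card A = 5" for A :: "'a set"
    using card_hfold_sumset_3_cases_5[OF that] card_hfold_sumset_le[OF that(1), of 3] that(2)
    by (auto simp: eval_nat_numeral)
  ultimately show ?thesis
    unfolding sumset_sizes_def by blast
qed

end
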